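(* Let $S$ be a completely (totally) ordered, complete idempotent semifield, let $a_i=(a_{i1},\dots,a_{in})$ and $b_i=(b_{i1},\dots,b_{in})$ be row vectors with entries in $S$, and let $\sigma_i\in S_n$ be a permutation and $0\le k\le n$ such that $a_{i,\sigma_i(j)}\le b_{i,\sigma_i(j)}$ for $j=1,\dots,k$ and $b_{i,\sigma_i(j)}<a_{i,\sigma_i(j)}$ for $j=k+1,\dots,n$. Put $J_k(i)=\{j : 1\le j\le n,\ a_{i,\sigma_i(j)}\le b_{i,\sigma_i(j)}\}$. If $b_i\not< a_i$ (i.e. it is not the case that $b_{ij}<a_{ij}$ for every $j$), then the set of solutions $x\in S^n$ of $a_ix\le b_ix$ is a semimodule $M_i$ generated by the $k(n+1-k)$ vectors given, for every $j\in J_k(i)$, by $$e_{\sigma_i(j)}\quad\text{and}\quad e_{\sigma_i(j)}\vee\bigl(a_{i,\sigma_i(\ell)}^{-1}\,b_{i,\sigma_i(j)}\bigr)e_{\sigma_i(\ell)},\quad \ell\notin J_k(i).$$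
   Context: The set of scalars $S$ is a completely ordered, complete idempotent semifield: $S$ is totally ordered and complete, with least element $\mathbf 0$, endowed with two composition laws $\vee$ and $\cdot$ such that: (i) $(S,\vee)$ is an idempotent commutative monoid with neutral element $\mathbf 0$, and the order is given by $s\le t\iff s\vee t=t$; (ii) $(S\setminus\{\mathbf 0\},\cdot)$ is an abelian group with neutral element $\mathbf 1$; (iii) $\cdot$ is distributive over $\vee$; (iv) $\mathbf 0$ is absorbing: $\mathbf 0\cdot s=\mathbf 0$ for all $s\in S$. $e_1,\dots,e_n$ is the canonical basis of $S^n$ ($e_j$ has $\mathbf 1$ in position $j$ and $\mathbf 0$ elsewhere). The scalar product of a row $a_i$ with $x\in S^n$ is written by concatenation: $a_ix=\bigvee_{j=1}^n a_{ij}x_j$. The semimodule generated by a finite set of vectors of $S^n$ is the set of all finite combinations $\bigvee_r\lambda_r v_r$ with $\lambda_r\in S$. *)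

theory Defs
  imports "Jordan_Normal_Form.Matrix" "HOL-Combinatorics.Permutations"
begin

text \<open>
  The idempotent addition is written \<open>+\<close>, its neutral element \<open>0\<close>, so that finite suprema
  \<open>\<Or>\<close> are ordinary finite sums; the group operation is \<open>*\<close> with unit \<open>1\<close>.
  Commutativity, associativity, distributivity and absorption of \<open>0\<close> come from
  \<open>comm_semiring_1\<close>, which also provides \<open>0 \<noteq> 1\<close>; with \<open>left_inverse_nonzero\<close> the nonzero
  elements form an abelian group. That \<open>0\<close> is the least element follows from \<open>le_iff_add_eq\<close>.

  Completeness is that of \<open>conditionally_complete_linorder\<close>: every nonempty set that is bounded
  above has a supremum. A greatest element is not required: if one existed, the group law would
  force the semifield to be \<open>{0, 1}\<close>, which excludes the max-plus semifield.
  \<open>inverse 0\<close> is left unspecified.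
\<close>

class complete_idempotent_semifield =
  comm_semiring_1 + inverse + conditionally_complete_linorder +
  assumes add_idem: "x + x = x"
    and le_iff_add_eq: "x \<le> y \<longleftrightarrow> x + y = y"
    and left_inverse_nonzero: "x \<noteq> 0 \<Longrightarrow> inverse x * x = 1"
    and divide_eq_mult_inverse: "x / y = x * inverse y"

definition is_subsemimodule :: "nat \<Rightarrow> 'a::complete_idempotent_semifield vec set \<Rightarrow> bool" where
  "is_subsemimodule n M \<longleftrightarrow>
     M \<subseteq> carrier_vec n \<and> 0\<^sub>v n \<in> M \<and>
     (\<forall>x\<in>M. \<forall>y\<in>M. x + y \<in> M) \<and> (\<forall>c. \<forall>x\<in>M. c \<cdot>\<^sub>v x \<in> M)"

definition semimodule_generated ::
    "nat \<Rightarrow> 'a::complete_idempotent_semifield vec set \<Rightarrow> 'a vec set" where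
  "semimodule_generated n V =
     {finsum_vec TYPE('a) n (\<lambda>v. c v \<cdot>\<^sub>v v) F |c F. finite F \<and> F \<subseteq> V}"

definition solution_set ::
    "nat \<Rightarrow> 'a::complete_idempotent_semifield vec \<Rightarrow> 'a vec \<Rightarrow> 'a vec set" where
  "solution_set n a b = {x \<in> carrier_vec n. a \<bullet> x \<le> b \<bullet> x}"

definition J_set ::
    "nat \<Rightarrow> (nat \<Rightarrow> nat) \<Rightarrow> 'a::complete_idempotent_semifield vec \<Rightarrow> 'a vec \<Rightarrow> nat set" where
  "J_set n \<sigma> a b = {j. j < n \<and> a $ \<sigma> j \<le> b $ \<sigma> j}"

text \<open>
  The generators form an indexed family, since different indices may yield the same vector
  (when \<open>b $ \<sigma> j = 0\<close>, every generator attached to \<open>j\<close> is the unit vector).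
  The index \<open>Inl j\<close> stands for the unit vector attached to \<open>j\<close>, and \<open>Inr (j, l)\<close> for the
  second kind of generator.
\<close>

definition gen_index ::
    "nat \<Rightarrow> (nat \<Rightarrow> nat) \<Rightarrow> 'a::complete_idempotent_semifield vec \<Rightarrow> 'a vec
      \<Rightarrow> (nat + nat \<times> nat) set" where
  "gen_index n \<sigma> a b = J_set n \<sigma> a b <+> (J_set n \<sigma> a b \<times> ({0..<n} - J_set n \<sigma> a b))"

fun gen_vec ::
    "nat \<Rightarrow> (nat \<Rightarrow> nat) \<Rightarrow> 'a::complete_idempotent_semifield vec \<Rightarrow> 'a vec
      \<Rightarrow> nat + nat \<times> nat \<Rightarrow> 'a vec" where
  "gen_vec n \<sigma> a b (Inl j) = unit_vec n (\<sigma> j)"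
| "gen_vec n \<sigma> a b (Inr (j, l)) =
     unit_vec n (\<sigma> j) + (inverse (a $ \<sigma> l) * b $ \<sigma> j) \<cdot>\<^sub>v unit_vec n (\<sigma> l)"

end

theory Submission
  imports Defs
begin

text \<open>
  Over a totally ordered idempotent semifield a nonempty finite sum is a maximum and is
  therefore attained by one of its terms (\<open>sum_attained\<close>). So if \<open>x\<close> satisfies
  \<open>a \<bullet> x \<le> b \<bullet> x\<close>, then \<open>b \<bullet> x\<close> equals a single \<open>b $ p * x $ p\<close>, and this \<open>p\<close> can be taken
  among the indices with \<open>a $ p \<le> b $ p\<close>: at any other index with \<open>x $ p \<noteq> 0\<close> cancelling
  \<open>x $ p\<close> in \<open>a $ p * x $ p \<le> b $ p * x $ p\<close> would give \<open>a $ p \<le> b $ p\<close>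
  (\<open>right_side_attained_dominated\<close>). For this \<open>p\<close> the inequality splits into the
  separate conditions \<open>a $ q * x $ q \<le> b $ p * x $ p\<close> for all \<open>q\<close>, each involving just two
  coordinates of \<open>x\<close>. When \<open>b $ q < a $ q\<close>, the vectors supported on \<open>{p, q}\<close> that satisfy
  this condition are generated by \<open>e\<^sub>p\<close> and \<open>e\<^sub>p \<or> (inverse (a $ q) * b $ p) e\<^sub>q\<close>.

  To assemble \<open>x\<close> from the generators, idempotence makes exact bookkeeping of coefficients
  unnecessary: it suffices that for every coordinate \<open>i\<close> some element of the generated
  semimodule lies below \<open>x\<close> and agrees with \<open>x\<close> at \<open>i\<close> (\<open>subsemimodule_touching\<close>), and scaled
  generators do this. The converse inclusion holds because the solution set is a
  subsemimodule containing the generators, and the generated semimodule is the smallest such.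
\<close>

section \<open>Order and finite sums in an idempotent semifield\<close>

lemma idem_zero_le: "(0::'a::complete_idempotent_semifield) \<le> x"
  by (simp add: le_iff_add_eq)

lemma idem_le_zero: "(x::'a::complete_idempotent_semifield) \<le> 0 \<longleftrightarrow> x = 0"
  using idem_zero_le[of x] by (auto intro: antisym)

lemma idem_add_le_iff:
  fixes x y z :: "'a::complete_idempotent_semifield"
  shows "x + y \<le> z \<longleftrightarrow> x \<le> z \<and> y \<le> z"
proof
  assume le: "x + y \<le> z"
  have "x + z = x + (x + y + z)" "y + z = y + (x + y + z)"
    using le by (simp_all add: le_iff_add_eq)
  moreover have "x + (x + y + z) = (x + x) + y + z" "y + (x + y + z) = x + (y + y) + z"
    by (simp_all only: ac_simps)
  ultimately show "x \<le> z \<and> y \<le> z"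
    using le by (simp add: le_iff_add_eq add_idem)
next
  assume "x \<le> z \<and> y \<le> z"
  then show "x + y \<le> z"
    by (simp add: le_iff_add_eq add.assoc)
qed

lemma idem_le_add:
  fixes x y :: "'a::complete_idempotent_semifield"
  shows "x \<le> x + y" "y \<le> x + y"
  using idem_add_le_iff[of x y "x + y"] by auto

lemma idem_add_mono:
  fixes x y z w :: "'a::complete_idempotent_semifield"
  assumes "x \<le> z" "y \<le> w"
  shows "x + y \<le> z + w"
  using order_trans[OF assms(1) idem_le_add(1)] order_trans[OF assms(2) idem_le_add(2)]
  unfolding idem_add_le_iff by blast

lemma idem_mult_left_mono:
  fixes x y c :: "'a::complete_idempotent_semifield"
  shows "x \<le> y \<Longrightarrow> c * x \<le> c * y"
  unfolding le_iff_add_eq by (simp flip: distrib_left)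

lemma idem_mult_le_cancel:
  fixes x y c :: "'a::complete_idempotent_semifield"
  assumes "c \<noteq> 0" "c * x \<le> c * y"
  shows "x \<le> y"
  using idem_mult_left_mono[OF assms(2), of "inverse c"] left_inverse_nonzero[OF assms(1)]
  by (simp flip: mult.assoc)

lemma idem_sum_le_iff:
  fixes f :: "'b \<Rightarrow> 'a::complete_idempotent_semifield"
  assumes "finite A"
  shows "sum f A \<le> t \<longleftrightarrow> (\<forall>i\<in>A. f i \<le> t)"
  using assms by (induction A) (auto simp: idem_add_le_iff idem_zero_le)

lemma idem_sum_upper:
  fixes f :: "'b \<Rightarrow> 'a::complete_idempotent_semifield"
  assumes "finite A" "i \<in> A"
  shows "f i \<le> sum f A"
  using idem_sum_le_iff[OF assms(1), of f "sum f A"] assms(2) by blast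

lemma sum_attained:
  fixes f :: "'b \<Rightarrow> 'a::complete_idempotent_semifield"
  assumes "finite A" "A \<noteq> {}"
  shows "\<exists>i\<in>A. sum f A = f i"
  using assms
proof (induction A rule: finite_ne_induct)
  case (insert i A)
  then show ?case
    using linear[of "f i" "sum f A"] by (auto simp: le_iff_add_eq add.commute)
qed simp

section \<open>Generated semimodules\<close>

lemma semimodule_generated_subsemimodule:
  fixes V :: "'a::complete_idempotent_semifield vec set"
  assumes V: "V \<subseteq> carrier_vec n"
  shows "is_subsemimodule n (semimodule_generated n V)"
proof -
  let ?C = "\<lambda>c F. finsum_vec TYPE('a) n (\<lambda>v. c v \<cdot>\<^sub>v v) F"
  have car: "?C c F \<in> carrier_vec n" if "F \<subseteq> V" for c F
    using that V by (intro finsum_vec_closed) auto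
  have idx: "?C c F $ i = (\<Sum>v\<in>F. c v * v $ i)" if "finite F" "F \<subseteq> V" "i < n" for c F i
  proof -
    have "?C c F $ i = (\<Sum>v\<in>F. (c v \<cdot>\<^sub>v v) $ i)"
      using that V by (intro index_finsum_vec) auto
    also have "\<dots> = (\<Sum>v\<in>F. c v * v $ i)"
      using that V by (intro sum.cong) auto
    finally show ?thesis .
  qed
  have gen: "?C c F \<in> semimodule_generated n V" if "finite F" "F \<subseteq> V" for c F
    unfolding semimodule_generated_def using that by blast
  have add: "?C c F + ?C d G \<in> semimodule_generated n V"
    if "finite F" "F \<subseteq> V" "finite G" "G \<subseteq> V" for c F d G
  proof -
    define h where "h v = (if v \<in> F then c v else 0) + (if v \<in> G then d v else 0)" for v
    have FG: "finite (F \<union> G)" "F \<union> G \<subseteq> V" using that by auto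
    have "?C c F + ?C d G = ?C h (F \<union> G)"
    proof (rule eq_vecI)
      fix i assume "i < dim_vec (?C h (F \<union> G))"
      then have i: "i < n" using car[OF FG(2), of h] by simp
      have "?C h (F \<union> G) $ i =
          (\<Sum>v\<in>F \<union> G. if v \<in> F then c v * v $ i else 0) +
          (\<Sum>v\<in>F \<union> G. if v \<in> G then d v * v $ i else 0)"
        unfolding idx[OF FG i] sum.distrib[symmetric]
        by (intro sum.cong) (auto simp: h_def distrib_right)
      also have "\<dots> = (\<Sum>v\<in>F. c v * v $ i) + (\<Sum>v\<in>G. d v * v $ i)"
        using that by (simp flip: sum.inter_restrict add: Int_absorb1)
      also have "\<dots> = (?C c F + ?C d G) $ i"
        using that i car[of G d] idx[of F i c] idx[of G i d] by simp
      finally show "(?C c F + ?C d G) $ i = ?C h (F \<union> G) $ i" by simp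
    qed (use car[OF FG(2), of h] car[of G d] that in simp)
    then show ?thesis using gen[OF FG] by simp
  qed
  have smult: "s \<cdot>\<^sub>v ?C c F \<in> semimodule_generated n V" if F: "finite F" "F \<subseteq> V" for s c F
  proof -
    have "s \<cdot>\<^sub>v ?C c F = ?C (\<lambda>v. s * c v) F"
      using car[OF F(2), of c] car[OF F(2), of "\<lambda>v. s * c v"]
      by (intro eq_vecI) (simp_all add: idx[OF F] sum_distrib_left mult.assoc)
    then show ?thesis using gen[OF F] by simp
  qed
  have zero: "0\<^sub>v n \<in> semimodule_generated n V"
    using gen[of "{}"] by (simp add: finsum_vec_empty)
  have "semimodule_generated n V \<subseteq> carrier_vec n"
    unfolding semimodule_generated_def using car by blast
  moreover have "x + y \<in> semimodule_generated n V"
    if "x \<in> semimodule_generated n V" "y \<in> semimodule_generated n V" for x y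
    using that add unfolding semimodule_generated_def[of n V] mem_Collect_eq by blast
  moreover have "s \<cdot>\<^sub>v x \<in> semimodule_generated n V" if "x \<in> semimodule_generated n V" for s x
    using that smult unfolding semimodule_generated_def[of n V] mem_Collect_eq by blast
  ultimately show ?thesis
    unfolding is_subsemimodule_def using zero by blast
qed

lemma generator_in_semimodule_generated:
  fixes V :: "'a::complete_idempotent_semifield vec set"
  assumes "v \<in> V" "v \<in> carrier_vec n"
  shows "v \<in> semimodule_generated n V"
proof -
  have "finsum_vec TYPE('a) n (\<lambda>w. 1 \<cdot>\<^sub>v w) {v} = v"
    using assms
    by (subst finsum_vec_insert) (auto simp: finsum_vec_empty intro!: eq_vecI)
  then show ?thesis
    unfolding semimodule_generated_def using assms
    by (intro CollectI exI[of _ "\<lambda>_. 1"] exI[of _ "{v}"]) auto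
qed

lemma subsemimodule_finsum:
  fixes M :: "'a::complete_idempotent_semifield vec set"
  assumes M: "is_subsemimodule n M" and "finite F" and "\<And>i. i \<in> F \<Longrightarrow> w i \<in> M"
  shows "finsum_vec TYPE('a) n w F \<in> M"
  using assms(2,3)
proof (induction F)
  case empty
  then show ?case using M by (simp add: finsum_vec_empty is_subsemimodule_def)
next
  case (insert i F)
  have "w \<in> F \<rightarrow> carrier_vec n" "w i \<in> carrier_vec n"
    using insert M unfolding is_subsemimodule_def by blast+
  then show ?case
    using insert M by (simp add: finsum_vec_insert is_subsemimodule_def)
qed

lemma semimodule_generated_least:
  assumes "is_subsemimodule n M" "V \<subseteq> M"
  shows "semimodule_generated n V \<subseteq> M"
proof -
  have "finsum_vec TYPE('a) n (\<lambda>v. c v \<cdot>\<^sub>v v) F \<in> M" if "finite F" "F \<subseteq> V" for c F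
  proof (rule subsemimodule_finsum[OF assms(1) that(1)])
    show "c v \<cdot>\<^sub>v v \<in> M" if "v \<in> F" for v
      using that \<open>F \<subseteq> V\<close> assms unfolding is_subsemimodule_def by blast
  qed
  then show ?thesis unfolding semimodule_generated_def by blast
qed

text \<open>
  Choosing one touching element for each coordinate, their sum stays below \<open>x\<close> and reaches
  \<open>x\<close> at every coordinate, because addition is the supremum.
\<close>

lemma subsemimodule_touching:
  fixes M :: "'a::complete_idempotent_semifield vec set"
  assumes M: "is_subsemimodule n M" and x: "x \<in> carrier_vec n"
    and touch: "\<And>i. i < n \<Longrightarrow> \<exists>w\<in>M. w \<le> x \<and> w $ i = x $ i"
  shows "x \<in> M"
proof -
  obtain w where w: "\<And>i. i < n \<Longrightarrow> w i \<in> M" "\<And>i. i < n \<Longrightarrow> w i \<le> x"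
      "\<And>i. i < n \<Longrightarrow> w i $ i = x $ i"
    using touch by metis
  have wc: "w \<in> {0..<n} \<rightarrow> carrier_vec n"
    using w(1) M unfolding is_subsemimodule_def by auto
  have "x = finsum_vec TYPE('a) n w {0..<n}"
  proof (rule eq_vecI)
    show "dim_vec x = dim_vec (finsum_vec TYPE('a) n w {0..<n})"
      using x finsum_vec_closed[OF wc] by simp
  next
    fix i assume "i < dim_vec (finsum_vec TYPE('a) n w {0..<n})"
    then have i: "i < n" using finsum_vec_closed[OF wc] by simp
    have "(\<Sum>j\<in>{0..<n}. w j $ i) \<le> x $ i"
      using w(2) x i by (auto simp: idem_sum_le_iff less_eq_vec_def)
    moreover have "w i $ i \<le> (\<Sum>j\<in>{0..<n}. w j $ i)"
      using idem_sum_upper[of "{0..<n}" i "\<lambda>j. w j $ i"] i by simp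
    ultimately show "x $ i = finsum_vec TYPE('a) n w {0..<n} $ i"
      using w(3)[OF i] index_finsum_vec[OF _ i wc] by simp
  qed
  moreover have "finsum_vec TYPE('a) n w {0..<n} \<in> M"
    using w(1) by (intro subsemimodule_finsum[OF M]) auto
  ultimately show ?thesis by simp
qed

section \<open>The solutions of a two-sided linear inequality\<close>

lemma solution_set_subsemimodule:
  fixes a b :: "'a::complete_idempotent_semifield vec"
  assumes a: "a \<in> carrier_vec n" and b: "b \<in> carrier_vec n"
  shows "is_subsemimodule n (solution_set n a b)"
  using assms unfolding is_subsemimodule_def solution_set_def
  by (auto simp: scalar_prod_add_distrib idem_add_mono idem_mult_left_mono)

lemma unit_vec_solution:
  fixes a b :: "'a::complete_idempotent_semifield vec"
  assumes "p < n" "a $ p \<le> b $ p"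
  shows "unit_vec n p \<in> solution_set n a b"
  using assms by (simp add: solution_set_def)

text \<open>
  The coefficient at \<open>q\<close> is the largest one for which the contribution of \<open>q\<close> to the left side
  does not exceed the contribution \<open>b $ p\<close> of \<open>p\<close> to the right side.
\<close>

lemma mixed_vec_solution:
  fixes a b :: "'a::complete_idempotent_semifield vec"
  assumes a: "a \<in> carrier_vec n" and b: "b \<in> carrier_vec n"
    and p: "p < n" "a $ p \<le> b $ p" and q: "q < n" "a $ q \<noteq> 0"
  shows "unit_vec n p + (inverse (a $ q) * b $ p) \<cdot>\<^sub>v unit_vec n q \<in> solution_set n a b"
proof -
  have ev: "c \<bullet> (unit_vec n p + t \<cdot>\<^sub>v unit_vec n q) = c $ p + t * c $ q"
    if "c \<in> carrier_vec n" for c :: "'a vec" and t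
    using that p(1) q(1) by (subst scalar_prod_add_distrib[of _ n]) auto
  have "inverse (a $ q) * b $ p * a $ q = (inverse (a $ q) * a $ q) * b $ p"
    by (simp only: ac_simps)
  then have "inverse (a $ q) * b $ p * a $ q = b $ p"
    using left_inverse_nonzero[OF q(2)] by simp
  then have "a $ p + inverse (a $ q) * b $ p * a $ q \<le> b $ p"
    using p(2) by (simp add: idem_add_le_iff)
  also have "\<dots> \<le> b $ p + inverse (a $ q) * b $ p * b $ q"
    by (rule idem_le_add)
  finally show ?thesis
    using a b by (simp add: solution_set_def ev)
qed

text \<open>
  An index \<open>s\<close> attaining \<open>b \<bullet> x\<close> satisfies \<open>a $ s * x $ s \<le> a \<bullet> x \<le> b $ s * x $ s\<close>, and a nonzero
  \<open>x $ s\<close> can be cancelled. The index \<open>r\<close> supplies \<open>p\<close> in the degenerate case \<open>b \<bullet> x = 0\<close>.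
\<close>

lemma right_side_attained_dominated:
  fixes a b :: "'a::complete_idempotent_semifield vec"
  assumes a: "a \<in> carrier_vec n" and b: "b \<in> carrier_vec n"
    and x: "x \<in> solution_set n a b" and r: "r < n" "a $ r \<le> b $ r"
  shows "\<exists>p<n. a $ p \<le> b $ p \<and> b \<bullet> x = b $ p * x $ p"
proof -
  have xc: "x \<in> carrier_vec n" and le: "a \<bullet> x \<le> b \<bullet> x"
    using x by (auto simp: solution_set_def)
  have sp: "c \<bullet> x = (\<Sum>i\<in>{0..<n}. c $ i * x $ i)" for c
    using xc by (simp add: scalar_prod_def)
  obtain s where s: "s < n" "b \<bullet> x = b $ s * x $ s"
    using sum_attained[of "{0..<n}" "\<lambda>i. b $ i * x $ i"] r(1) sp[of b] by auto
  show ?thesis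
  proof (cases "x $ s = 0")
    case True
    \<comment> \<open>The whole right side vanishes, so its term at \<open>r\<close> attains it too.\<close>
    then have "\<forall>i\<in>{0..<n}. b $ i * x $ i \<le> 0"
      using idem_sum_le_iff[of "{0..<n}" "\<lambda>i. b $ i * x $ i" 0] s(2) sp[of b] by simp
    then have "b $ r * x $ r = 0" using r(1) by (simp add: idem_le_zero)
    then show ?thesis using r s True by auto
  next
    case False
    have "a $ s * x $ s \<le> a \<bullet> x"
      using idem_sum_upper[of "{0..<n}" s "\<lambda>i. a $ i * x $ i"] s(1) sp[of a] by simp
    then have "x $ s * a $ s \<le> x $ s * b $ s"
      using le s(2) by (simp add: mult.commute)
    then show ?thesis using idem_mult_le_cancel[OF False] s by blast
  qed
qed

text \<open>
  With \<open>\<alpha> = a $ q\<close>, \<open>\<beta> = b $ p\<close>, \<open>y = x $ q\<close>, \<open>z = x $ p\<close>, the factor \<open>c\<close> scales the mixed vector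
  of \<open>p\<close> and \<open>q\<close> so that it meets \<open>x\<close> at \<open>q\<close> without exceeding it at \<open>p\<close>. If \<open>\<beta> \<noteq> 0\<close>, then \<open>c\<close>
  is forced to be \<open>\<alpha> * y / \<beta>\<close>, which is at most \<open>z\<close>; if \<open>\<beta> = 0\<close>, then \<open>y = 0\<close> and \<open>c = 0\<close> works.
\<close>

lemma mixed_scaling_factor:
  fixes \<alpha> \<beta> y z :: "'a::complete_idempotent_semifield"
  assumes \<alpha>: "\<alpha> \<noteq> 0" and le: "\<alpha> * y \<le> \<beta> * z"
  shows "\<exists>c\<le>z. c * (inverse \<alpha> * \<beta>) = y"
proof (cases "\<beta> = 0")
  case True
  then have "\<alpha> * y \<le> \<alpha> * 0" using le by simp
  then have "y = 0" using idem_mult_le_cancel[OF \<alpha>] idem_le_zero by blast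
  then show ?thesis using idem_zero_le by (intro exI[of _ 0]) simp
next
  case False
  define c where "c = inverse \<beta> * (\<alpha> * y)"
  have "\<beta> * c = (inverse \<beta> * \<beta>) * (\<alpha> * y)" unfolding c_def by (simp only: ac_simps)
  then have "\<beta> * c = \<alpha> * y" using left_inverse_nonzero[OF False] by simp
  then have "c \<le> z" using le idem_mult_le_cancel[OF False] by simp
  moreover have "c * (inverse \<alpha> * \<beta>) = inverse \<alpha> * (\<beta> * c)" by (simp add: ac_simps)
  then have "c * (inverse \<alpha> * \<beta>) = y"
    using \<open>\<beta> * c = \<alpha> * y\<close> left_inverse_nonzero[OF \<alpha>] by (simp flip: mult.assoc)
  ultimately show ?thesis by blast
qed

text \<open>
  Where \<open>a $ i \<le> b $ i\<close>, the vector \<open>x $ i \<cdot>\<^sub>v e\<^sub>i\<close> touches \<open>x\<close> at \<open>i\<close>. At any other index a scaled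
  mixed vector does; its first index \<open>p\<close> is one where \<open>b \<bullet> x\<close> is attained, since the term of
  \<open>p\<close> then bounds every \<open>a $ i * x $ i\<close>.
\<close>

lemma solution_in_subsemimodule:
  fixes a b :: "'a::complete_idempotent_semifield vec"
  assumes a: "a \<in> carrier_vec n" and b: "b \<in> carrier_vec n"
    and M: "is_subsemimodule n M"
    and r: "r < n" "a $ r \<le> b $ r"
    and unit: "\<And>p. p < n \<Longrightarrow> a $ p \<le> b $ p \<Longrightarrow> unit_vec n p \<in> M"
    and mixed: "\<And>p q. p < n \<Longrightarrow> a $ p \<le> b $ p \<Longrightarrow> q < n \<Longrightarrow> b $ q < a $ q \<Longrightarrow>
      unit_vec n p + (inverse (a $ q) * b $ p) \<cdot>\<^sub>v unit_vec n q \<in> M"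
    and x: "x \<in> solution_set n a b"
  shows "x \<in> M"
proof (rule subsemimodule_touching[OF M])
  show xc: "x \<in> carrier_vec n" using x by (simp add: solution_set_def)
  have smult: "c \<cdot>\<^sub>v v \<in> M" if "v \<in> M" for c v
    using that M by (simp add: is_subsemimodule_def)
  fix i assume i: "i < n"
  show "\<exists>w\<in>M. w \<le> x \<and> w $ i = x $ i"
  proof (cases "a $ i \<le> b $ i")
    case True
    have "x $ i \<cdot>\<^sub>v unit_vec n i \<le> x"
      using xc i by (auto simp: less_eq_vec_def unit_vec_def idem_zero_le)
    then show ?thesis
      using smult[OF unit[OF i True], of "x $ i"] i
      by (intro bexI[of _ "x $ i \<cdot>\<^sub>v unit_vec n i"]) auto
  next
    case False
    then have lt: "b $ i < a $ i" by simp
    then have nz: "a $ i \<noteq> 0" using idem_zero_le[of "b $ i"] by auto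
    obtain p where p: "p < n" "a $ p \<le> b $ p" "b \<bullet> x = b $ p * x $ p"
      using right_side_attained_dominated[OF a b x r] by blast
    have "a $ i * x $ i \<le> a \<bullet> x"
      using idem_sum_upper[of "{0..<n}" i "\<lambda>i. a $ i * x $ i"] i xc
      by (simp add: scalar_prod_def)
    also have "\<dots> \<le> b $ p * x $ p" using x p(3) by (simp add: solution_set_def)
    finally obtain c where c: "c \<le> x $ p" "c * (inverse (a $ i) * b $ p) = x $ i"
      using mixed_scaling_factor[OF nz] by blast
    have pi: "p \<noteq> i" using p(2) False by blast
    let ?w = "c \<cdot>\<^sub>v (unit_vec n p + (inverse (a $ i) * b $ p) \<cdot>\<^sub>v unit_vec n i)"
    have w: "?w $ t = (if t = p then c else if t = i then x $ i else 0)" if "t < n" for t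
      using that p(1) i pi c(2) by (auto simp: unit_vec_def)
    have "?w \<le> x"
      unfolding less_eq_vec_def using xc w c(1) by (auto simp: idem_zero_le simp del: index_smult_vec(1))
    moreover have "?w \<in> M" using smult mixed p i lt by blast
    moreover have "?w $ i = x $ i" using w[OF i] pi by simp
    ultimately show ?thesis by blast
  qed
qed

theorem proposition1:
  fixes a b :: "'a::complete_idempotent_semifield vec"
    and \<sigma> :: "nat \<Rightarrow> nat"
    and n k :: nat
  assumes "a \<in> carrier_vec n" and "b \<in> carrier_vec n"
    and "\<sigma> permutes {0..<n}"
    and "k \<le> n"
    and "\<And>j. j < k \<Longrightarrow> a $ \<sigma> j \<le> b $ \<sigma> j"
    and "\<And>j. k \<le> j \<Longrightarrow> j < n \<Longrightarrow> b $ \<sigma> j < a $ \<sigma> j"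
    and "\<not> (\<forall>j<n. b $ j < a $ j)"
  shows "is_subsemimodule n (solution_set n a b)
    \<and> solution_set n a b = semimodule_generated n (gen_vec n \<sigma> a b ` gen_index n \<sigma> a b)
    \<and> card (gen_index n \<sigma> a b) = k * (n + 1 - k)"
proof (intro conjI)
  let ?V = "gen_vec n \<sigma> a b ` gen_index n \<sigma> a b"
  note a = assms(1) and b = assms(2)
  have \<sigma>_lt: "\<sigma> j < n" if "j < n" for j
    using permutes_in_image[OF assms(3), of j] that by simp
  have \<sigma>_onto: "\<exists>j<n. p = \<sigma> j" if "p < n" for p
    using permutes_image[OF assms(3)] that by (metis atLeastLessThan_iff imageE zero_le)
  show sub: "is_subsemimodule n (solution_set n a b)"
    by (rule solution_set_subsemimodule[OF a b])
  have V_sol: "?V \<subseteq> solution_set n a b"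
  proof
    fix v assume "v \<in> ?V"
    then consider (unit) j where "j \<in> J_set n \<sigma> a b" "v = unit_vec n (\<sigma> j)"
      | (mixed) j l where "j \<in> J_set n \<sigma> a b" "l < n" "l \<notin> J_set n \<sigma> a b"
          "v = unit_vec n (\<sigma> j) + (inverse (a $ \<sigma> l) * b $ \<sigma> j) \<cdot>\<^sub>v unit_vec n (\<sigma> l)"
      unfolding gen_index_def by force
    then show "v \<in> solution_set n a b"
    proof cases
      case unit
      then show ?thesis by (auto simp: J_set_def \<sigma>_lt intro: unit_vec_solution)
    next
      case mixed
      \<comment> \<open>A coefficient exceeding another one is nonzero, so \<open>inverse\<close> is meaningful here.\<close>
      have "a $ \<sigma> l \<noteq> 0"
        using mixed idem_zero_le[of "b $ \<sigma> l"] by (auto simp: J_set_def)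
      then show ?thesis
        using mixed by (auto simp: J_set_def \<sigma>_lt intro: mixed_vec_solution[OF a b])
    qed
  qed
  then have V_car: "?V \<subseteq> carrier_vec n" by (auto simp: solution_set_def)
  obtain r where r: "r < n" "a $ r \<le> b $ r" using assms(7) by (auto simp: not_less)
  have gen: "v \<in> semimodule_generated n ?V" if "v \<in> ?V" for v
    using that V_car by (intro generator_in_semimodule_generated) auto
  show "solution_set n a b = semimodule_generated n ?V"
  proof
    show "semimodule_generated n ?V \<subseteq> solution_set n a b"
      by (rule semimodule_generated_least[OF sub V_sol])
    show "solution_set n a b \<subseteq> semimodule_generated n ?V"
    proof
      fix x assume "x \<in> solution_set n a b"
      then show "x \<in> semimodule_generated n ?V"
      proof (rule solution_in_subsemimodule[OF a b
            semimodule_generated_subsemimodule[OF V_car] r, rotated -1])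
        fix p assume p: "p < n" "a $ p \<le> b $ p"
        then obtain j where j: "j < n" "p = \<sigma> j" using \<sigma>_onto by blast
        then have jJ: "j \<in> J_set n \<sigma> a b" using p by (simp add: J_set_def)
        then have "gen_vec n \<sigma> a b (Inl j) \<in> ?V"
          by (intro imageI) (auto simp: gen_index_def)
        then show "unit_vec n p \<in> semimodule_generated n ?V" using gen j by simp
        fix q assume q: "q < n" "b $ q < a $ q"
        then obtain l where l: "l < n" "q = \<sigma> l" using \<sigma>_onto by blast
        then have "l \<notin> J_set n \<sigma> a b" using q by (simp add: J_set_def)
        then have "gen_vec n \<sigma> a b (Inr (j, l)) \<in> ?V"
          using jJ l(1) by (intro imageI) (auto simp: gen_index_def)
        then show "unit_vec n p + (inverse (a $ q) * b $ p) \<cdot>\<^sub>v unit_vec n q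
            \<in> semimodule_generated n ?V"
          using gen j l by simp
      qed
    qed
  qed
  have J: "J_set n \<sigma> a b = {0..<k}"
    using assms(4-6) by (force simp: J_set_def not_le[symmetric])
  have "card (gen_index n \<sigma> a b) = k + k * (n - k)"
    using assms(4) unfolding gen_index_def J
    by (subst card_Plus) (auto simp: card_cartesian_product card_Diff_subset)
  also have "\<dots> = k * (n + 1 - k)"
    using assms(4) by (simp add: Suc_diff_le)
  finally show "card (gen_index n \<sigma> a b) = k * (n + 1 - k)" .
qed

end
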